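(* Let $c, d \in \mathbb{Z}$ with $d \ge 2$, let $\phi(x) = x^d + c$, and let $D_{d,c} = \{n \in \mathbb{Z} : n \ge 1,\ n \mid \phi^n(0)\}$. The set $D_{d,c}$ is finite if and only if either (1) $d$ is even and $c = 1$, or (2) $d = 2$ and $c = -2$. Moreover, if $D_{d,c}$ is finite, then $D_{d,c} = \{1,2\}$.
   Context: Here $\phi^n$ denotes the $n$-th iterate of $\phi$. *)

theory Defs
  imports Main
begin

definition phi :: "nat \<Rightarrow> int \<Rightarrow> int \<Rightarrow> int" where
  "phi d c x = x ^ d + c"

definition D :: "nat \<Rightarrow> int \<Rightarrow> nat set" where
  "D d c = {n. n \<ge> 1 \<and> int n dvd (phi d c ^^ n) 0}"

end

theory Submission
  imports Defs "HOL-Number_Theory.Cong" "HOL-Computational_Algebra.Primes"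
begin

text \<open>
  Write \<open>a\<^sub>n = \<phi>\<^sup>n(0)\<close>. Since \<open>n dvd m\<close> implies \<open>a\<^sub>n dvd a\<^sub>m\<close>, the set is closed under
  \<open>n \<mapsto> \<bar>a\<^sub>n\<bar>\<close> whenever \<open>a\<^sub>n \<noteq> 0\<close>; so it is infinite as soon as some \<open>a\<^sub>n\<close> vanishes or the
  set has an element beyond which \<open>\<bar>a\<^sub>n\<bar> > n\<close>. Outside the two exceptional families one of these
  happens at once, with witness \<open>1\<close>, \<open>2\<close> or \<open>3\<close>.

  For \<open>c = 1\<close> and \<open>d\<close> even, let \<open>p\<close> be the least odd prime factor of an element \<open>n\<close>, and let
  \<open>r\<close> be the least positive index with \<open>p dvd a\<^sub>r\<close>. As \<open>\<phi>(1) = \<phi>(-1)\<close>, the orbit of \<open>0\<close>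
  cannot exhaust the residues modulo \<open>p\<close>, so \<open>r < p\<close>. But \<open>r dvd n\<close> and \<open>4\<close> never
  divides \<open>a\<^sub>n\<close>, which leaves \<open>r \<le> 2\<close> and \<open>p dvd a\<^sub>2 = 2\<close>.
\<close>

section \<open>Congruences and divisibility along the orbit of 0\<close>

lemma cong_phi_funpow:
  assumes "[x = y] (mod m)"
  shows "[(phi d c ^^ k) x = (phi d c ^^ k) y] (mod m)"
  using assms by (induction k) (auto simp: phi_def intro!: cong_add cong_pow)

lemma cong_phi_orbit_shift:
  assumes "[(phi d c ^^ i) 0 = (phi d c ^^ j) 0] (mod m)"
  shows "[(phi d c ^^ (k + i)) 0 = (phi d c ^^ (k + j)) 0] (mod m)"
  using cong_phi_funpow[OF assms] by (simp add: funpow_add)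

text \<open>Modulo \<open>a\<^sub>n\<close> the orbit is back at 0 after \<open>n\<close> steps, so
  every further block of \<open>n\<close> steps returns it to 0 again.\<close>

lemma phi_orbit_dvd_mult: "(phi d c ^^ n) 0 dvd (phi d c ^^ (n * k)) 0"
proof (induction k)
  case (Suc k)
  let ?a = "(phi d c ^^ n) 0"
  have "[(phi d c ^^ (n * k)) ?a = (phi d c ^^ (n * k)) 0] (mod ?a)"
    by (intro cong_phi_funpow) (simp add: cong_0_iff)
  then have "?a dvd (phi d c ^^ (n * k)) ?a"
    using Suc by (simp add: cong_dvd_iff)
  then show ?case
    by (simp add: add.commute[of n] funpow_add)
qed simp

section \<open>The infinite cases\<close>

lemma infinite_D_if_orbit_zero:
  assumes "k \<ge> 1" "(phi d c ^^ k) 0 = 0"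
  shows "infinite (D d c)"
proof -
  have "range (\<lambda>j. k * Suc j) \<subseteq> D d c"
  proof (intro image_subsetI)
    fix j
    have "(phi d c ^^ (k * Suc j)) 0 = 0"
      using phi_orbit_dvd_mult[of k d c "Suc j"] assms(2) by simp
    then show "k * Suc j \<in> D d c"
      using assms(1) unfolding D_def by simp
  qed
  moreover have "inj (\<lambda>j. k * Suc j)"
    using assms(1) by (auto simp: inj_on_def)
  ultimately show ?thesis
    using infinite_iff_countable_subset by blast
qed

text \<open>Membership of \<open>n\<close> makes the absolute value of \<open>a\<^sub>n\<close> a
  multiple of \<open>n\<close>, so \<open>a\<^sub>n\<close> divides the term at that index.\<close>

lemma abs_orbit_in_D:
  assumes "n \<in> D d c" "(phi d c ^^ n) 0 \<noteq> 0"
  shows "nat \<bar>(phi d c ^^ n) 0\<bar> \<in> D d c"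
proof -
  let ?m = "nat \<bar>(phi d c ^^ n) 0\<bar>"
  have "int n dvd int ?m"
    using assms(1) by (simp add: D_def)
  then obtain k where "?m = n * k"
    unfolding int_dvd_int_iff by (elim dvdE)
  then have "(phi d c ^^ n) 0 dvd (phi d c ^^ ?m) 0"
    using phi_orbit_dvd_mult[of n d c k] by metis
  then show ?thesis
    using assms(2) by (simp add: D_def)
qed

text \<open>The maximum of a finite \<open>D d c\<close> would be sent to a larger element.\<close>

lemma infinite_D_if_growth:
  assumes "m \<in> D d c" and growth: "\<And>n. n \<ge> m \<Longrightarrow> \<bar>(phi d c ^^ n) 0\<bar> > int n"
  shows "infinite (D d c)"
proof
  assume fin: "finite (D d c)"
  define n where "n = Max (D d c)"
  have n: "n \<in> D d c" "n \<ge> m"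
    using Max_in[OF fin] Max_ge[OF fin assms(1)] assms(1) unfolding n_def by blast+
  have gt: "\<bar>(phi d c ^^ n) 0\<bar> > int n"
    using growth n(2) .
  then have "nat \<bar>(phi d c ^^ n) 0\<bar> \<in> D d c"
    by (intro abs_orbit_in_D n) auto
  then have "nat \<bar>(phi d c ^^ n) 0\<bar> \<le> n"
    unfolding n_def using fin by (intro Max_ge)
  then show False
    using gt by linarith
qed

text \<open>The three bounds at \<open>k\<close> propagate together: the absolute value of
  \<open>x ^ d\<close> is at least three times that of \<open>x\<close>, and adding \<open>c\<close>
  costs at most one of these three, so the absolute value at least doubles.\<close>

lemma phi_orbit_growth:
  assumes "d \<ge> 2" "n \<ge> k"
    and "\<bar>(phi d c ^^ k) 0\<bar> \<ge> 3" "\<bar>(phi d c ^^ k) 0\<bar> \<ge> \<bar>c\<bar>" "\<bar>(phi d c ^^ k) 0\<bar> > int k"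
  shows "\<bar>(phi d c ^^ n) 0\<bar> > int n"
proof -
  have "\<bar>(phi d c ^^ n) 0\<bar> \<ge> 3 \<and> \<bar>(phi d c ^^ n) 0\<bar> \<ge> \<bar>c\<bar> \<and> \<bar>(phi d c ^^ n) 0\<bar> > int n"
    using assms(2)
  proof (induction rule: dec_induct)
    case (step n)
    define x where "x = (phi d c ^^ n) 0"
    have x: "\<bar>x\<bar> \<ge> 3" "\<bar>x\<bar> \<ge> \<bar>c\<bar>" "\<bar>x\<bar> > int n"
      using step.IH by (auto simp: x_def)
    have "3 * \<bar>x\<bar> \<le> \<bar>x\<bar> ^ 2"
      unfolding power2_eq_square using x by (intro mult_right_mono) auto
    also have "\<dots> \<le> \<bar>x\<bar> ^ d"
      using assms(1) x by (intro power_increasing) auto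
    also have "\<dots> = \<bar>x ^ d\<bar>"
      by (simp add: power_abs)
    finally have "\<bar>x ^ d + c\<bar> \<ge> 2 * \<bar>x\<bar>"
      using x by linarith
    moreover have "(phi d c ^^ Suc n) 0 = x ^ d + c"
      by (simp add: x_def phi_def)
    ultimately show ?case
      using x by simp
  qed (use assms in auto)
  then show ?thesis by simp
qed

lemma infinite_D:
  assumes d: "d \<ge> 2" and "\<not> (even d \<and> c = 1)" "\<not> (d = 2 \<and> c = -2)"
  shows "infinite (D d c)"
proof -
  have witness: "infinite (D d c)"
    if "k \<ge> 1" "int k dvd (phi d c ^^ k) 0" "\<bar>(phi d c ^^ k) 0\<bar> \<ge> 3"
      "\<bar>(phi d c ^^ k) 0\<bar> \<ge> \<bar>c\<bar>" "\<bar>(phi d c ^^ k) 0\<bar> > int k" for k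
    using that phi_orbit_growth[OF d] by (intro infinite_D_if_growth[of k]) (auto simp: D_def)
  have pos: "d > 0"
    using d by simp
  have one: "(phi d c ^^ 1) 0 = c"
    using pos by (simp add: zero_power phi_def)
  have two: "(phi d c ^^ 2) 0 = c ^ d + c"
    using pos by (simp add: zero_power phi_def numeral_2_eq_2)
  have three: "(phi d c ^^ 3) 0 = (c ^ d + c) ^ d + c"
    using pos by (simp add: zero_power phi_def numeral_3_eq_3)
  have pow4: "(2::int) ^ d \<ge> 4"
    using power_increasing[of 2 d "2::int"] d by simp
  \<comment> \<open>The growing orbits have witness 1 in the first case, 2 in the next three and 3
    in the last; for \<open>c = 0\<close> the orbit vanishes at index 1, for \<open>c = -1\<close>
    with \<open>d\<close> even at index 2.\<close>
  consider "\<bar>c\<bar> \<ge> 3" | "c = 2" | "c = -2" "odd d" | "c = -2" "even d" "d \<ge> 3"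
    | "c = 0" | "c = -1" "even d" | "\<bar>c\<bar> = 1" "odd d"
    using assms by (cases "even d") (force | linarith)+
  then show ?thesis
  proof cases
    case 1
    then show ?thesis
      using one by (intro witness[of 1]) auto
  next
    case 2
    then show ?thesis
      using two pow4 d by (intro witness[of 2]) auto
  next
    case 3
    then show ?thesis
      using two pow4 d by (intro witness[of 2]) auto
  next
    case 4
    \<comment> \<open>Here the second term is \<open>2 ^ d - 2\<close>; \<open>pow4\<close> alone
      would not bring it up to 3.\<close>
    have "(2::int) ^ d \<ge> 8"
      using power_increasing[of 3 d "2::int"] 4 by simp
    then show ?thesis
      using two 4 d by (intro witness[of 2]) auto
  next
    case 5
    then show ?thesis
      using one by (intro infinite_D_if_orbit_zero[of 1]) auto
  next
    case 6
    then show ?thesis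
      using two by (intro infinite_D_if_orbit_zero[of 2]) auto
  next
    case 7
    \<comment> \<open>For odd \<open>d\<close> and \<open>c = 1\<close> or \<open>c = -1\<close>,
      the orbit begins 0, \<open>c\<close>, \<open>2 * c\<close>.\<close>
    have a3: "(phi d c ^^ 3) 0 = c * (2 ^ d + 1)"
    proof (cases "c = 1")
      case False
      then have "c = -1" using 7 by linarith
      then show ?thesis using three 7 by simp
    qed (use three in simp)
    have "[(2::int) ^ d = (-1) ^ d] (mod 3)"
      by (intro cong_pow) (simp add: cong_def)
    then have "(3::int) dvd 2 ^ d + 1"
      using 7 by (simp add: cong_iff_dvd_diff)
    then show ?thesis
      using a3 pow4 7 by (intro witness[of 3]) (auto simp: abs_mult)
  qed
qed

section \<open>The rank of apparition of a modulus\<close>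

text \<open>The bound \<open>r \<ge> 1\<close> discards the trivial zero at index 0. The value is
  meaningful only if \<open>m\<close> divides some later term, hence the recurring hypotheses on
  \<open>n\<close>.\<close>

definition phi_rank :: "nat \<Rightarrow> int \<Rightarrow> int \<Rightarrow> nat" where
  "phi_rank d c m = (LEAST r. r \<ge> 1 \<and> m dvd (phi d c ^^ r) 0)"

lemma phi_rank:
  assumes "n \<ge> 1" "m dvd (phi d c ^^ n) 0"
  shows "phi_rank d c m \<ge> 1" "m dvd (phi d c ^^ phi_rank d c m) 0"
  using LeastI[of "\<lambda>r. r \<ge> 1 \<and> m dvd (phi d c ^^ r) 0" n] assms by (auto simp: phi_rank_def)

lemma phi_rank_le:
  assumes "n \<ge> 1" "m dvd (phi d c ^^ n) 0"
  shows "phi_rank d c m \<le> n"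
  using Least_le[of "\<lambda>r. r \<ge> 1 \<and> m dvd (phi d c ^^ r) 0" n] assms by (auto simp: phi_rank_def)

text \<open>Dropping full blocks of rank length leaves a zero modulo \<open>m\<close> at index
  \<open>n mod ?r\<close>, which minimality forces to be 0.\<close>

lemma phi_rank_dvd:
  assumes "n \<ge> 1" "m dvd (phi d c ^^ n) 0"
  shows "phi_rank d c m dvd n"
proof -
  let ?r = "phi_rank d c m"
  have "m dvd (phi d c ^^ (?r * (n div ?r))) 0"
    using phi_rank(2)[OF assms] phi_orbit_dvd_mult dvd_trans by blast
  then have "[(phi d c ^^ (n mod ?r + ?r * (n div ?r))) 0 = (phi d c ^^ (n mod ?r + 0)) 0] (mod m)"
    by (intro cong_phi_orbit_shift) (simp add: cong_0_iff)
  then have "m dvd (phi d c ^^ (n mod ?r)) 0"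
    using assms(2) by (simp add: cong_dvd_iff)
  moreover have "n mod ?r < ?r"
    using phi_rank(1)[OF assms] by simp
  ultimately have "n mod ?r = 0"
    using phi_rank_le[of "n mod ?r" m d c] by (cases "n mod ?r = 0") linarith+
  then show ?thesis by (simp add: dvd_eq_mod_eq_0)
qed

text \<open>A coincidence pushed forward by \<open>?r - j\<close> steps would give a zero at an
  index below the rank. The third assumption keeps that index positive: it excludes only the pair 0
  and \<open>?r\<close>, where both terms vanish modulo \<open>m\<close>.\<close>

lemma phi_orbit_not_cong:
  assumes "i < j" "j \<le> phi_rank d c m" "i \<ge> 1 \<or> j < phi_rank d c m"
    and "n \<ge> 1" "m dvd (phi d c ^^ n) 0"
  shows "\<not> [(phi d c ^^ i) 0 = (phi d c ^^ j) 0] (mod m)"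
proof
  let ?r = "phi_rank d c m"
  assume "[(phi d c ^^ i) 0 = (phi d c ^^ j) 0] (mod m)"
  then have "[(phi d c ^^ (?r - j + i)) 0 = (phi d c ^^ (?r - j + j)) 0] (mod m)"
    by (rule cong_phi_orbit_shift)
  then have "m dvd (phi d c ^^ (?r - j + i)) 0"
    using phi_rank(2)[OF assms(4,5)] assms(2) by (simp add: cong_dvd_iff)
  then have "?r \<le> ?r - j + i"
    using assms(2,3) by (intro phi_rank_le) linarith+
  then show False
    using assms(1,2) by linarith
qed

lemma phi_rank_less_prime:
  assumes "even d" "prime p" "odd p" "n \<ge> 1" "int p dvd (phi d c ^^ n) 0"
  shows "phi_rank d c (int p) < p"
proof (rule ccontr)
  let ?r = "phi_rank d c (int p)"
  assume "\<not> ?r < p"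
  then have r: "?r \<ge> p" by simp
  define f where "f i = (phi d c ^^ i) 0 mod int p" for i
  have p: "p > 2"
    using assms(2,3) prime_ge_2_nat[of p] by (cases "p = 2") auto
  have "inj_on f {..<?r}"
  proof (rule linorder_inj_onI')
    fix i j assume "i \<in> {..<?r}" "j \<in> {..<?r}" "i < j"
    then show "f i \<noteq> f j"
      using phi_orbit_not_cong[of i j d c "int p" n] assms by (simp add: f_def cong_def)
  qed
  then have "card (f ` {..<?r}) = ?r"
    by (simp add: card_image)
  moreover have "f ` {..<?r} \<subseteq> {0..<int p}"
    using p by (auto simp: f_def)
  \<comment> \<open>At least \<open>p\<close> distinct values lie among only \<open>p\<close>
    residues.\<close>
  ultimately have surj: "f ` {..<?r} = {0..<int p}"
    using r by (intro card_seteq) auto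
  have "1 \<in> f ` {..<?r}"
    using surj p by simp
  then obtain i where i: "i < ?r" "f i = 1"
    by auto
  have "int p - 1 \<in> f ` {..<?r}"
    using surj p by simp
  then obtain j where j: "j < ?r" "f j = int p - 1"
    by auto
  have "i \<noteq> j"
    using i j p by auto
  have "[(phi d c ^^ i) 0 = 1] (mod int p)"
    using i p by (simp add: f_def cong_def)
  then have "[(phi d c ^^ Suc i) 0 = 1 ^ d + c] (mod int p)"
    by (simp add: phi_def cong_pow cong_add del: power_one)
  moreover have "[(phi d c ^^ j) 0 = -1] (mod int p)"
    using j p by (simp add: f_def cong_def zmod_minus1)
  then have "[(phi d c ^^ Suc j) 0 = (-1) ^ d + c] (mod int p)"
    by (simp add: phi_def cong_pow cong_add del: power_minus_even)
  ultimately have "[(phi d c ^^ Suc i) 0 = (phi d c ^^ Suc j) 0] (mod int p)"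
    using assms(1) by (simp add: cong_def)
  \<comment> \<open>The successor indices lie between 1 and \<open>?r\<close>, so the larger may be
    the rank itself while the smaller is positive.\<close>
  moreover have "\<not> [(phi d c ^^ Suc (min i j)) 0 = (phi d c ^^ Suc (max i j)) 0] (mod int p)"
    using \<open>i \<noteq> j\<close> i j assms by (intro phi_orbit_not_cong[of _ _ _ _ _ n]) auto
  ultimately show False
    using \<open>i \<noteq> j\<close> by (cases "i < j") (auto simp: min_def max_def cong_sym_eq simp del: funpow.simps)
qed

section \<open>The two exceptional families\<close>

text \<open>Modulo 4 the map swaps 1 and 2, since 4 divides \<open>2 ^ d\<close>.\<close>

lemma not_four_dvd_orbit:
  assumes "d \<ge> 2" "even d" "n \<ge> 1"
  shows "\<not> 4 dvd (phi d 1 ^^ n) 0"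
proof -
  have "(phi d 1 ^^ n) 0 mod 4 \<in> {1, 2}"
    using assms(3)
  proof (induction rule: dec_induct)
    case base
    have "d > 0" using assms(1) by simp
    then show ?case by (simp add: zero_power phi_def)
  next
    case (step n)
    let ?a = "(phi d 1 ^^ n) 0"
    have a': "(phi d 1 ^^ Suc n) 0 mod 4 = ((?a mod 4) ^ d + 1) mod 4"
      by (simp add: phi_def mod_add_left_eq[symmetric, of "_ ^ d"] power_mod
          del: mod_add_left_eq)
    have "(2::int) ^ 2 dvd 2 ^ d"
      using assms(1) by (rule le_imp_power_dvd)
    then have "((2::int) ^ d + 1) mod 4 = 1"
      by (auto elim!: dvdE)
    then show ?case
      using step.IH a' by auto
  qed
  then show ?thesis by (auto simp: dvd_eq_mod_eq_0)
qed

lemma D_even_one: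
  assumes "d \<ge> 2" "even d"
  shows "D d 1 = {1, 2}"
proof
  have pos: "d > 0"
    using assms(1) by simp
  have two: "(phi d 1 ^^ 2) 0 = 2"
    using pos by (simp add: zero_power phi_def numeral_2_eq_2)
  then show "{1, 2} \<subseteq> D d 1"
    by (auto simp: D_def)
  show "D d 1 \<subseteq> {1, 2}"
  proof
    fix n assume "n \<in> D d 1"
    then have n: "n \<ge> 1" "int n dvd (phi d 1 ^^ n) 0"
      by (auto simp: D_def)
    have four: "\<not> 4 dvd n"
    proof
      assume "4 dvd n"
      then have "int 4 dvd int n" by (simp only: int_dvd_int_iff)
      then show False
        using not_four_dvd_orbit[OF assms n(1)] n(2) dvd_trans by (metis of_nat_numeral)
    qed
    have no_odd: False if "\<exists>p. prime p \<and> odd p \<and> p dvd n"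
    proof -
      define p where "p = (LEAST p. prime p \<and> odd p \<and> p dvd n)"
      have p: "prime p" "odd p" "p dvd n"
        using LeastI_ex[OF that] by (auto simp: p_def)
      have least: "p \<le> q" if "prime q" "odd q" "q dvd n" for q
        using that unfolding p_def by (intro Least_le) auto
      have dvd: "int p dvd (phi d 1 ^^ n) 0"
        using p(3) n(2) dvd_trans by (metis int_dvd_int_iff)
      define r where "r = phi_rank d 1 (int p)"
      have r: "r \<ge> 1" "r < p" "r dvd n" "int p dvd (phi d 1 ^^ r) 0"
        using phi_rank[OF n(1) dvd] phi_rank_dvd[OF n(1) dvd]
          phi_rank_less_prime[OF assms(2) p(1,2) n(1) dvd] by (auto simp: r_def)
      \<comment> \<open>A prime factor of \<open>r\<close> divides \<open>n\<close> and is smaller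
        than \<open>p\<close>, so by the choice of \<open>p\<close> it is 2; and 4 does not divide
        \<open>r\<close>.\<close>
      have "r dvd 2"
      proof -
        have prime_two: "q = 2" if "prime q" "q dvd r" for q
          using least[of q] that r dvd_imp_le[of q r] primes_dvd_imp_eq[of 2 q] dvd_trans[of q r n]
          by (cases "even q") auto
        show ?thesis
        proof (cases "even r")
          case True
          then obtain s where s: "r = 2 * s" by (auto elim: evenE)
          have "s = 1"
          proof (rule ccontr)
            assume "s \<noteq> 1"
            then obtain q where q: "prime q" "q dvd s"
              using prime_factor_nat by blast
            then have "q = 2" using prime_two s by simp
            then have "4 dvd r" using q s by auto
            then show False using four r(3) dvd_trans by blast
          qed
          then show ?thesis using s by simp
        next
          case False
          then have "r = 1"
            using prime_two prime_factor_nat by blast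
          then show ?thesis by simp
        qed
      qed
      then obtain k where "2 = r * k" by (elim dvdE)
      then have "int p dvd 2"
        using r(4) phi_orbit_dvd_mult[of r d 1 k] two dvd_trans by metis
      then have "int p dvd int 2" by simp
      then have "p dvd 2" by (simp only: int_dvd_int_iff)
      then show False
        using p primes_dvd_imp_eq[of p 2] by auto
    qed
    show "n \<in> {1, 2}"
    proof (cases "n = 1")
      case False
      then obtain q where q: "prime q" "q dvd n"
        using prime_factor_nat by blast
      then have "q = 2"
        using no_odd primes_dvd_imp_eq[of 2 q] by (cases "even q") auto
      then obtain m where m: "n = 2 * m" using q by (auto elim: dvdE)
      \<comment> \<open>A prime factor of \<open>m\<close> is either odd, against
        \<open>no_odd\<close>, or 2, against \<open>four\<close>.\<close>
      have "m = 1"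
      proof (rule ccontr)
        assume "m \<noteq> 1"
        then obtain q where q: "prime q" "q dvd m"
          using prime_factor_nat by blast
        have "odd q"
          using q m four by (auto elim!: dvdE)
        then show False
          using no_odd q dvd_mult[OF q(2)] unfolding m by blast
      qed
      then show ?thesis using m by simp
    qed simp
  qed
qed

text \<open>The orbit 0, -2, 2, 2, ... stops at the fixed point 2, so from index 2 on members must
  divide 2.\<close>

lemma D_two_minus_two: "D 2 (-2) = {1, 2}"
proof -
  have two: "(phi 2 (-2) ^^ n) 0 = 2" if "n \<ge> 2" for n
    using that by (induction rule: dec_induct) (auto simp: phi_def numeral_2_eq_2)
  have one: "(phi 2 (-2) ^^ 1) 0 = -2"
    by (simp add: phi_def)
  have "n \<in> {1, 2}" if "n \<in> D 2 (-2)" for n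
  proof (cases "n \<ge> 2")
    case True
    then have "int n dvd 2" using that two by (simp add: D_def)
    then show ?thesis using True zdvd_imp_le[of "int n" 2] by simp
  qed (use that in \<open>auto simp: D_def\<close>)
  moreover have "1 \<in> D 2 (-2)" "2 \<in> D 2 (-2)"
    using one two[of 2] by (auto simp: D_def)
  ultimately show ?thesis by blast
qed

theorem theorem3p3:
  fixes c :: int and d :: nat
  assumes "d \<ge> 2"
  shows "(finite (D d c) \<longleftrightarrow> (even d \<and> c = 1) \<or> (d = 2 \<and> c = -2))
    \<and> (finite (D d c) \<longrightarrow> D d c = {1, 2})"
proof (cases "(even d \<and> c = 1) \<or> (d = 2 \<and> c = -2)")
  case True
  then have "D d c = {1, 2}"
    using D_even_one[OF assms] D_two_minus_two by auto
  then show ?thesis using True by simp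
next
  case False
  then show ?thesis using infinite_D[OF assms] by auto
qed

end
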